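(* Let $X\subset\mathbb{R}^n$ be a closed, nonempty, proper definable subset, let $a\in X$ and $v\in V_a(X)$. If the directional reaching radius vanishes, $r_v(a)=0$, then $v$ is tangent to $M_X$ at $a$, i.e. $v\in C_aM_X$.
   Context: "Definable" means definable in a fixed polynomially bounded o-minimal structure on the field $\mathbb{R}$. $\|\cdot\|$ is the Euclidean norm and $d(p,X)$ the Euclidean distance. For $p\in\mathbb{R}^n$ put $m(p)=\{x\in X\mid \|p-x\|=d(p,X)\}$; the medial axis of $X$ is $M_X=\{p\in\mathbb{R}^n\mid \# m(p)>1\}$. For a set $E\subset\mathbb{R}^n$ and a point $a\in\overline{E}$, the Peano tangent cone is $C_aE=\{v\in\mathbb{R}^n\mid \exists\, E\ni x_\nu\to a,\ \exists\,\lambda_\nu>0:\ \lambda_\nu(x_\nu-a)\to v\}$ (in particular $v\in C_aM_X$ includes the assertion that $a\in\overline{M_X}$). The normal cone at $a\in X$ is $N_a(X)=\{v\in\mathbb{R}^n\mid \langle v,w\rangle\leqslant 0\ \text{for all } w\in C_aX\}$, and $V_a(X)=N_a(X)\cap\mathbb{S}^{n-1}$. For $a\in X$, $v\in V_a(X)$, the directional reaching radius is $r_v(a)=\sup\{t\geqslant 0\mid a\in m(a+tv)\}\in[0,+\infty]$. *)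

theory Defs
  imports "HOL-Analysis.Analysis"
begin

text \<open>O-minimal structures on the real field, following van den Dries. A point of
  \<open>\<real>\<^sup>n\<close> is a list of length \<open>n\<close>, and \<open>S n\<close> is the collection of the definable
  subsets of \<open>\<real>\<^sup>n\<close>.\<close>

locale structure_on_reals =
  fixes S :: "nat \<Rightarrow> real list set set"
  assumes subset_carrier: "A \<in> S n \<Longrightarrow> A \<subseteq> {xs. length xs = n}"
    and empty_mem: "{} \<in> S n"
    and union_mem: "A \<in> S n \<Longrightarrow> B \<in> S n \<Longrightarrow> A \<union> B \<in> S n"
    and compl_mem: "A \<in> S n \<Longrightarrow> {xs. length xs = n} - A \<in> S n"
    and cylinder_left: "A \<in> S n \<Longrightarrow> {x # xs | x xs. xs \<in> A} \<in> S (Suc n)"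
    and cylinder_right: "A \<in> S n \<Longrightarrow> {xs @ [x] | xs x. xs \<in> A} \<in> S (Suc n)"
    and diagonal: "i < n \<Longrightarrow> j < n \<Longrightarrow> {xs. length xs = n \<and> xs ! i = xs ! j} \<in> S n"
    and projection: "A \<in> S (Suc n) \<Longrightarrow> butlast ` A \<in> S n"

text \<open>Here \<^const>\<open>is_interval\<close> admits bounded and unbounded, open, closed and half-open
  intervals, as well as points, so \<open>S 1\<close> consists precisely of the finite unions of points and
  open intervals. In particular all real constants are definable.\<close>

locale o_minimal_field_structure = structure_on_reals +
  assumes less_mem: "{[x, y] | x y. x < y} \<in> S 2"
    and add_mem: "{[x, y, x + y] | x y. True} \<in> S 3"
    and mult_mem: "{[x, y, x * y] | x y. True} \<in> S 3"
    and o_minimal: "S 1 = {(\<lambda>x. [x]) ` \<Union>F | F. finite F \<and> (\<forall>I\<in>F. is_interval I)}"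

locale poly_bounded_o_minimal_structure = o_minimal_field_structure +
  assumes poly_bounded:
    "{[x, f x] | x. True} \<in> S 2 \<Longrightarrow> \<exists>N::nat. \<forall>\<^sub>F t in at_top. \<bar>f t\<bar> \<le> t ^ N"

text \<open>A subset of \<^typ>\<open>real ^ 'n\<close> is read as a set of lists by enumerating the index type.
  Each \<open>S n\<close> is closed under permutation of the coordinates, so the choice of the
  enumeration \<open>e\<close> is immaterial.\<close>

definition definable_set :: "(nat \<Rightarrow> real list set set) \<Rightarrow> (real ^ 'n) set \<Rightarrow> bool" where
  "definable_set S X \<longleftrightarrow>
     (\<exists>e. bij_betw e {..<CARD('n)} (UNIV :: 'n set) \<and>
          (\<lambda>x. map (\<lambda>i. x $ e i) [0..<CARD('n)]) ` X \<in> S CARD('n))"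

definition nearest_points :: "'a::euclidean_space set \<Rightarrow> 'a \<Rightarrow> 'a set" where
  "nearest_points X p = {x \<in> X. norm (p - x) = infdist p X}"

text \<open>Not phrased with \<^const>\<open>card\<close>, which is \<open>0\<close> on infinite sets.\<close>

definition medial_axis :: "'a::euclidean_space set \<Rightarrow> 'a set" where
  "medial_axis X = {p. \<exists>x\<in>nearest_points X p. \<exists>y\<in>nearest_points X p. x \<noteq> y}"

text \<open>The cone is empty if \<open>a \<notin> closure E\<close>.\<close>

definition tangent_cone :: "'a::euclidean_space set \<Rightarrow> 'a \<Rightarrow> 'a set" where
  "tangent_cone E a =
     {v. \<exists>(x :: nat \<Rightarrow> 'a) (l :: nat \<Rightarrow> real).
           (\<forall>k. x k \<in> E) \<and> x \<longlonglongrightarrow> a \<and> (\<forall>k. l k > 0) \<and>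
           (\<lambda>k. l k *\<^sub>R (x k - a)) \<longlonglongrightarrow> v}"

definition normal_cone :: "'a::euclidean_space set \<Rightarrow> 'a \<Rightarrow> 'a set" where
  "normal_cone X a = {v. \<forall>w\<in>tangent_cone X a. v \<bullet> w \<le> 0}"

definition unit_normals :: "'a::euclidean_space set \<Rightarrow> 'a \<Rightarrow> 'a set" where
  "unit_normals X a = normal_cone X a \<inter> sphere 0 1"

text \<open>For \<open>a \<in> X\<close> the supremum is over a set containing \<open>0\<close>, hence nonnegative.\<close>

definition reaching_radius :: "'a::euclidean_space set \<Rightarrow> 'a \<Rightarrow> 'a \<Rightarrow> ereal" where
  "reaching_radius X a v =
     (SUP t\<in>{t::real. 0 \<le> t \<and> a \<in> nearest_points X (a + t *\<^sub>R v)}. ereal t)"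

end

theory Submission
  imports Defs
begin

text \<open>If \<open>v\<close> is not tangent to the medial axis at \<open>a\<close>, the axis misses a truncated
  open cone at \<open>a\<close> around \<open>v\<close>. Let \<open>x\<close> be nearest to \<open>a + t v\<close>. As \<open>v\<close> is normal,
  \<open>\<bar>x - a\<bar> = o(t)\<close>, so the ray from \<open>x\<close> through \<open>a + t v\<close> has almost the direction \<open>v\<close> and
  remains in the cone up to a length \<open>\<sigma>\<close> independent of \<open>t\<close>. As in Federer's work on sets of
  positive reach, \<open>x\<close> stays nearest along the ray as long as the ray does not leave an open set
  free of the medial axis. Letting \<open>t\<close> tend to \<open>0\<close> shows that \<open>a\<close> is nearest to
  \<open>a + \<sigma> v\<close>, so the reaching radius is at least \<open>\<sigma>\<close>.\<close>

section \<open>Nearest points and their continuity off the medial axis\<close>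

lemma nearest_points_exists:
  assumes "closed X" "X \<noteq> {}"
  obtains z where "z \<in> nearest_points X p"
  using infdist_attains_inf[OF assms, of p]
  unfolding nearest_points_def dist_norm by (metis (mono_tags, lifting) mem_Collect_eq)

lemma nearest_points_iff_le:
  "z \<in> nearest_points X p \<longleftrightarrow> z \<in> X \<and> norm (p - z) \<le> infdist p X"
  unfolding nearest_points_def using infdist_le[of z X p] by (auto simp: dist_norm)

lemma nearest_points_norm_le:
  assumes "z \<in> nearest_points X p" "x \<in> X"
  shows "norm (p - z) \<le> norm (p - x)"
  using assms infdist_le[of x X p] by (auto simp: nearest_points_def dist_norm)

lemma nearest_points_unique:
  assumes "p \<notin> medial_axis X" "x \<in> nearest_points X p" "y \<in> nearest_points X p"
  shows "x = y"
  using assms by (auto simp: medial_axis_def)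

lemma nearest_points_limit:
  assumes "closed X" and "\<And>k. z k \<in> nearest_points X (p k)"
    and "z \<longlonglongrightarrow> w" "p \<longlonglongrightarrow> q"
  shows "w \<in> nearest_points X q"
proof -
  have "w \<in> X"
    using assms closed_sequentially[of X z w] by (auto simp: nearest_points_def)
  moreover have "(\<lambda>k. norm (p k - z k)) \<longlonglongrightarrow> norm (q - w)"
    by (intro tendsto_intros assms)
  moreover have "(\<lambda>k. norm (p k - z k)) \<longlonglongrightarrow> infdist q X"
    using assms(2) tendsto_infdist[OF assms(4), of X] by (simp add: nearest_points_def)
  ultimately show ?thesis
    by (auto simp: nearest_points_def intro: LIMSEQ_unique)
qed

lemma tendsto_zero_if_less_inverse:
  fixes f :: "nat \<Rightarrow> 'a::real_normed_vector"
  assumes "\<And>k. norm (f k) < inverse (real (Suc k))"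
  shows "f \<longlonglongrightarrow> 0"
  by (rule Lim_null_comparison[OF always_eventually LIMSEQ_inverse_real_of_nat])
    (use assms in \<open>blast intro: less_imp_le\<close>)

text \<open>By contradiction and compactness: nearest points to points tending to \<open>y\<close>
  stay bounded, the limit of a convergent subsequence is nearest to \<open>y\<close>, and off the
  medial axis it can only be \<open>z\<close>.\<close>

lemma nearest_points_continuous:
  assumes "closed X" and y: "y \<notin> medial_axis X" and z: "z \<in> nearest_points X y" and "e > 0"
  shows "\<exists>d>0. \<forall>y' z'. norm (y' - y) < d \<longrightarrow> z' \<in> nearest_points X y' \<longrightarrow> norm (z' - z) < e"
proof (rule ccontr)
  assume "\<not> ?thesis"
  then have "\<exists>y' z'. norm (y' - y) < inverse (real (Suc k)) \<and> z' \<in> nearest_points X y' \<and>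
      norm (z' - z) \<ge> e" for k
    by (metis inverse_positive_iff_positive not_le of_nat_0_less_iff zero_less_Suc)
  then obtain p w where p: "\<And>k. norm (p k - y) < inverse (real (Suc k))"
    and w: "\<And>k. w k \<in> nearest_points X (p k)" and far: "\<And>k. norm (w k - z) \<ge> e"
    by metis
  have lim: "p \<longlonglongrightarrow> y"
    by (rule LIM_zero_cancel, rule tendsto_zero_if_less_inverse) (rule p)
  \<comment> \<open>The point \<open>z\<close> competes with \<open>w k\<close>, so |w k| <= 2 |p k|
    + |z|, and \<open>p k\<close> is within 1 of \<open>y\<close>.\<close>
  have "norm (w k) \<le> 2 + 2 * norm y + norm z" for k
  proof -
    have "norm (p k - w k) \<le> norm (p k - z)"
      using z by (intro nearest_points_norm_le[OF w]) (simp add: nearest_points_def)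
    moreover have "norm (p k - y) < 1"
      using p[of k] by (rule less_le_trans) (simp add: field_simps)
    ultimately show ?thesis by norm
  qed
  then have "bounded (range w)" by (auto simp: bounded_iff)
  then obtain l r where r: "strict_mono (r :: nat \<Rightarrow> nat)" and l: "(w \<circ> r) \<longlonglongrightarrow> l"
    using bounded_imp_convergent_subsequence by blast
  have "l \<in> nearest_points X y"
    by (rule nearest_points_limit[OF \<open>closed X\<close> _ l LIMSEQ_subseq_LIMSEQ[OF lim r]])
      (simp add: w)
  then have "l = z" using y z nearest_points_unique by blast
  have "(\<lambda>k. norm ((w \<circ> r) k - z)) \<longlonglongrightarrow> norm (l - z)"
    by (intro tendsto_intros l)
  then have "norm (l - z) \<ge> e"
    by (rule LIMSEQ_le_const) (simp add: far)
  with \<open>l = z\<close> \<open>e > 0\<close> show False by simp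
qed

section \<open>Growth of the distance function off the medial axis\<close>

text \<open>A nearest point \<open>z'\<close> of the shifted point is close to \<open>z\<close>, so
  for small \<open>e\<close> the vector \<open>n\<close> points almost directly away from
  \<open>z'\<close> too. Expanding the square of |y - z' + h n| then gives growth at rate
  \<open>1 - e\<close>.\<close>

lemma infdist_increases_away_from_nearest:
  assumes "closed X" and y: "y \<notin> medial_axis X" and z: "z \<in> nearest_points X y"
    and "y \<notin> X" and e: "0 < e" "e \<le> 1"
  defines "n \<equiv> (1 / infdist y X) *\<^sub>R (y - z)"
  shows "\<exists>h0>0. \<forall>h. 0 < h \<and> h < h0 \<longrightarrow> infdist (y + h *\<^sub>R n) X \<ge> infdist y X + (1 - e) * h"
proof -
  define d where "d = infdist y X"
  have ne: "X \<noteq> {}" using z by (auto simp: nearest_points_def)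
  have "d > 0"
    using assms(1) ne \<open>y \<notin> X\<close> in_closed_iff_infdist_zero[of X y] infdist_nonneg[of y X]
    unfolding d_def by linarith
  have yz: "norm (y - z) = d" using z by (simp add: nearest_points_def d_def)
  have n: "n = (1 / d) *\<^sub>R (y - z)" "norm n = 1"
    using yz \<open>d > 0\<close> by (auto simp: n_def d_def)
  \<comment> \<open>The tolerance scales with \<open>d\<close>, so that passing from
    \<open>z\<close> to \<open>z'\<close> costs at most the fraction \<open>e\<close> of
    \<open>n \<bullet> (y - z) = d\<close>.\<close>
  obtain h0 where "h0 > 0" and h0: "\<And>y' z'. norm (y' - y) < h0 \<Longrightarrow> z' \<in> nearest_points X y' \<Longrightarrow>
      norm (z' - z) < e * d"
    using nearest_points_continuous[OF \<open>closed X\<close> y z, of "e * d"] \<open>d > 0\<close> e by auto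
  have "infdist (y + h *\<^sub>R n) X \<ge> d + (1 - e) * h" if h: "0 < h" "h < h0" for h
  proof -
    obtain z' where z': "z' \<in> nearest_points X (y + h *\<^sub>R n)"
      using nearest_points_exists[OF \<open>closed X\<close> ne] by blast
    have close: "norm (z' - z) < e * d"
      by (rule h0[OF _ z']) (use h n in auto)
    have "norm (y - z') \<ge> d"
      using z' infdist_le[of z' X y] by (auto simp: nearest_points_def d_def dist_norm)
    then have far: "(norm (y - z'))\<^sup>2 \<ge> d\<^sup>2"
      using \<open>d > 0\<close> by (intro power_mono) auto
    have "n \<bullet> (y - z) = d"
      using yz \<open>d > 0\<close> by (simp add: n(1) flip: power2_norm_eq_inner) (simp add: power2_eq_square)
    moreover have "n \<bullet> (z' - z) \<le> e * d"
      using norm_cauchy_schwarz[of n "z' - z"] n(2) close by simp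
    ultimately have inner: "n \<bullet> (y - z') \<ge> (1 - e) * d"
      by (simp add: inner_diff_right algebra_simps)
    \<comment> \<open>The squares are compared term by term, by \<open>far\<close>, by
      \<open>inner\<close>, and by (1 - e)^2 <= 1.\<close>
    have "(d + (1 - e) * h)\<^sup>2 = d\<^sup>2 + 2 * h * ((1 - e) * d) + (1 - e)\<^sup>2 * h\<^sup>2"
      by (simp add: power2_eq_square algebra_simps)
    also have "\<dots> \<le> (norm (y - z'))\<^sup>2 + 2 * h * (n \<bullet> (y - z')) + 1 * h\<^sup>2"
      using far inner h e
      by (intro add_mono mult_left_mono mult_right_mono) (auto simp: power_le_one)
    also have "\<dots> = (norm ((y - z') + h *\<^sub>R n))\<^sup>2"
      using n(2) unfolding power2_norm_eq_inner norm_eq_1 inner_add_left inner_add_right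
      by (simp add: inner_commute power2_eq_square)
    also have "(y - z') + h *\<^sub>R n = (y + h *\<^sub>R n) - z'" by simp
    also have "norm \<dots> = infdist (y + h *\<^sub>R n) X"
      using z' by (simp add: nearest_points_def)
    finally show ?thesis
      by (rule power2_le_imp_le) (rule infdist_nonneg)
  qed
  then show ?thesis using \<open>h0 > 0\<close> by (auto simp: d_def)
qed

text \<open>This replaces the gradient flow of the distance function: a point maximising the distance
  subject to an almost optimal growth rate must lie on the boundary of the ball, since otherwise
  it could be moved further away from its nearest point.\<close>

lemma infdist_max_growth_approx:
  assumes "closed X" "X \<noteq> {}" "q \<notin> X" "s \<ge> 0" "cball q s \<inter> medial_axis X = {}"
    and e: "0 < e" "e \<le> 1"
  shows "\<exists>y\<in>cball q s. infdist y X \<ge> infdist q X + (1 - e) * s"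
proof -
  define K where "K = cball q s \<inter> {y. infdist q X + (1 - e) * norm (y - q) \<le> infdist y X}"
  have "compact K"
    unfolding K_def by (intro compact_Int_closed compact_cball closed_Collect_le continuous_intros)
  moreover have "q \<in> K" using \<open>s \<ge> 0\<close> by (simp add: K_def)
  ultimately obtain y where "y \<in> K" and max: "\<And>y'. y' \<in> K \<Longrightarrow> infdist y' X \<le> infdist y X"
    using continuous_attains_sup[of K "\<lambda>y. infdist y X"]
      continuous_on_infdist[OF continuous_on_id, of K X] by auto
  have y: "norm (y - q) \<le> s" "infdist q X + (1 - e) * norm (y - q) \<le> infdist y X"
    using \<open>y \<in> K\<close> by (auto simp: K_def dist_norm norm_minus_commute)
  show ?thesis
  proof (cases "norm (y - q) = s")
    case True
    with y \<open>y \<in> K\<close> show ?thesis by (auto simp: K_def)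
  next
    case False
    have "infdist q X > 0"
      using assms in_closed_iff_infdist_zero[of X q] infdist_nonneg[of q X] by linarith
    then have pos: "infdist y X > 0"
      using y e by (smt (verit) mult_nonneg_nonneg norm_ge_zero)
    then have "y \<notin> X" by auto
    have "y \<notin> medial_axis X" using \<open>y \<in> K\<close> assms(5) by (auto simp: K_def)
    obtain z where z: "z \<in> nearest_points X y"
      using nearest_points_exists[OF assms(1,2)] by blast
    define n where "n = (1 / infdist y X) *\<^sub>R (y - z)"
    have "norm n = 1" using z pos by (auto simp: n_def nearest_points_def)
    \<comment> \<open>half of \<open>e\<close>, so that the distance grows strictly even when \<open>e = 1\<close>\<close>
    obtain h0 where "h0 > 0" and
      h0: "\<And>h. 0 < h \<Longrightarrow> h < h0 \<Longrightarrow> infdist (y + h *\<^sub>R n) X \<ge> infdist y X + (1 - e / 2) * h"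
      using infdist_increases_away_from_nearest[OF assms(1) \<open>y \<notin> medial_axis X\<close> z \<open>y \<notin> X\<close>, of "e / 2"] e
      unfolding n_def by auto
    \<comment> \<open>Short enough for the growth estimate and for the shifted point to stay in the
      ball; positive because \<open>y\<close> is interior.\<close>
    define h where "h = min (h0 / 2) (s - norm (y - q))"
    have h: "0 < h" "h < h0" "h \<le> s - norm (y - q)"
      using \<open>h0 > 0\<close> False y by (auto simp: h_def)
    let ?y = "y + h *\<^sub>R n"
    have grow: "infdist ?y X \<ge> infdist y X + (1 - e / 2) * h" using h0 h by blast
    have dist: "norm (?y - q) \<le> norm (y - q) + h"
      using norm_triangle_ineq[of "y - q" "h *\<^sub>R n"] \<open>norm n = 1\<close> h by (simp add: algebra_simps)
    have "(1 - e) * norm (?y - q) \<le> (1 - e) * norm (y - q) + (1 - e) * h"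
      using mult_left_mono[OF dist, of "1 - e"] e by (simp add: algebra_simps)
    moreover have "(1 - e) * h \<le> (1 - e / 2) * h" "0 < (1 - e / 2) * h"
      using h e by (auto intro!: mult_right_mono mult_pos_pos)
    ultimately have "infdist q X + (1 - e) * norm (?y - q) \<le> infdist ?y X"
      and "infdist ?y X > infdist y X" and "norm (?y - q) \<le> s"
      using grow y dist h by linarith+
    then have "?y \<in> K" "infdist ?y X > infdist y X"
      by (auto simp: K_def dist_norm norm_minus_commute)
    with max show ?thesis by fastforce
  qed
qed

text \<open>The maximiser over the ball is chosen before \<open>e\<close>, so the estimates for all
  \<open>e\<close> hold at one and the same point, and \<open>e\<close> can tend to 0.\<close>

lemma infdist_max_growth:
  assumes "closed X" "X \<noteq> {}" "q \<notin> X" "s \<ge> 0" "cball q s \<inter> medial_axis X = {}"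
  shows "\<exists>y\<in>cball q s. infdist y X \<ge> infdist q X + s"
proof -
  obtain y where "y \<in> cball q s" and max: "\<And>y'. y' \<in> cball q s \<Longrightarrow> infdist y' X \<le> infdist y X"
    using continuous_attains_sup[of "cball q s" "\<lambda>y. infdist y X"] \<open>s \<ge> 0\<close>
      continuous_on_infdist[OF continuous_on_id, of "cball q s" X] by auto
  have approx: "infdist q X + (1 - e) * s \<le> infdist y X" if "0 < e" "e \<le> 1" for e
    using infdist_max_growth_approx[OF assms that] max by force
  have "((\<lambda>e. infdist q X + (1 - e) * s) \<longlongrightarrow> infdist q X + (1 - 0) * s) (at_right 0)"
    by (intro tendsto_intros)
  moreover have "\<forall>\<^sub>F e in at_right 0. infdist q X + (1 - e) * s \<le> infdist y X"
    unfolding eventually_at_right_field by (rule exI[of _ 1]) (auto intro: approx)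
  ultimately have "infdist q X + (1 - 0) * s \<le> infdist y X"
    by (rule tendsto_upperbound) simp
  with \<open>y \<in> cball q s\<close> show ?thesis by auto
qed

section \<open>Extending nearest points along rays\<close>

text \<open>Some \<open>y\<close> in the ball has distance at least \<open>r + s\<close> from
  \<open>X\<close>, hence from \<open>x\<close>. The triangle inequality through the centre is then
  an equality, which puts \<open>y\<close> on the ray from \<open>x\<close> in direction
  \<open>u\<close>.\<close>

lemma nearest_point_extends_in_ball:
  assumes "closed X" "norm u = 1" and x: "x \<in> nearest_points X (x + r *\<^sub>R u)" and "r > 0"
    and "s \<ge> 0" "cball (x + r *\<^sub>R u) s \<inter> medial_axis X = {}"
  shows "x \<in> nearest_points X (x + (r + s) *\<^sub>R u)"
proof -
  define q where "q = x + r *\<^sub>R u"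
  have "x \<in> X" and d: "infdist q X = r"
    using x \<open>norm u = 1\<close> \<open>r > 0\<close> by (auto simp: nearest_points_def q_def)
  then have "q \<notin> X" using \<open>r > 0\<close> by auto
  moreover have "X \<noteq> {}" using \<open>x \<in> X\<close> by blast
  ultimately have "\<exists>y\<in>cball q s. infdist y X \<ge> infdist q X + s"
    using assms by (intro infdist_max_growth) (auto simp: q_def)
  then obtain y where y: "dist q y \<le> s" "infdist y X \<ge> r + s"
    using d by auto
  have nq: "norm (q - x) = r" using \<open>norm u = 1\<close> \<open>r > 0\<close> by (simp add: q_def)
  have yx: "norm (y - x) \<ge> r + s"
    using infdist_le[OF \<open>x \<in> X\<close>, of y] y by (simp add: dist_norm)
  \<comment> \<open>Sandwich: r + s <= |y - x| <= |q - x| + |y - q| <= r + s.\<close>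
  have "norm ((q - x) + (y - q)) = norm (q - x) + norm (y - q)" "norm (y - q) = s"
    using norm_triangle_ineq[of "q - x" "y - q"] yx y(1) nq
    by (auto simp: dist_norm norm_minus_commute)
  then have "r *\<^sub>R (y - q) = s *\<^sub>R (r *\<^sub>R u)"
    using nq norm_triangle_eq[of "q - x" "y - q"] by (simp add: q_def)
  then have "r *\<^sub>R (y - q) = r *\<^sub>R (s *\<^sub>R u)"
    by (simp add: mult.commute)
  then have "y = q + s *\<^sub>R u"
    using \<open>r > 0\<close> by (metis add.commute diff_add_cancel less_irrefl scaleR_cancel_left)
  then have "y = x + (r + s) *\<^sub>R u"
    by (simp add: q_def algebra_simps)
  then show ?thesis
    using y(2) \<open>x \<in> X\<close> \<open>norm u = 1\<close> \<open>r > 0\<close> \<open>s \<ge> 0\<close> by (auto simp: nearest_points_iff_le)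
qed

text \<open>Continuation: the radii at which \<open>x\<close> is still nearest form a compact set,
  and at its maximum \<open>R\<close> a ball inside \<open>W\<close> allows a further step unless
  \<open>R = r1\<close>.\<close>

lemma nearest_point_extends_along_ray:
  assumes "closed X" "norm u = 1" and x: "x \<in> nearest_points X (x + r0 *\<^sub>R u)" and "0 < r0" "r0 \<le> r1"
    and W: "open W" "W \<inter> medial_axis X = {}" "\<And>r. r0 \<le> r \<Longrightarrow> r \<le> r1 \<Longrightarrow> x + r *\<^sub>R u \<in> W"
  shows "x \<in> nearest_points X (x + r1 *\<^sub>R u)"
proof -
  define A where "A = {r0..r1} \<inter> {r. norm (x + r *\<^sub>R u - x) \<le> infdist (x + r *\<^sub>R u) X}"
  have "x \<in> X" using x by (simp add: nearest_points_def)
  then have A: "r \<in> A \<longleftrightarrow> r0 \<le> r \<and> r \<le> r1 \<and> x \<in> nearest_points X (x + r *\<^sub>R u)" for r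
    by (auto simp: A_def nearest_points_iff_le)
  have "compact A"
    unfolding A_def by (intro compact_Int_closed compact_Icc closed_Collect_le continuous_intros)
  moreover have "r0 \<in> A" using assms by (simp add: A)
  ultimately obtain R where "R \<in> A" and max: "\<And>r. r \<in> A \<Longrightarrow> r \<le> R"
    using compact_attains_sup[of A] by blast
  have R: "r0 \<le> R" "R \<le> r1" "x \<in> nearest_points X (x + R *\<^sub>R u)"
    using \<open>R \<in> A\<close> by (auto simp: A)
  obtain e where "e > 0" and e: "cball (x + R *\<^sub>R u) e \<subseteq> W"
    using W R open_contains_cball by metis
  \<comment> \<open>The cap \<open>r1 - R\<close> keeps \<open>R + s\<close> in \<open>A\<close>.
    Maximality of \<open>R\<close> then forces \<open>s \<le> 0\<close>, and since
    \<open>e > 0\<close> it must be the cap that vanishes.\<close>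
  define s where "s = min e (r1 - R)"
  have "s \<ge> 0" using R \<open>e > 0\<close> by (simp add: s_def)
  have "cball (x + R *\<^sub>R u) s \<subseteq> W"
    using e by (auto simp: s_def)
  then have "x \<in> nearest_points X (x + (R + s) *\<^sub>R u)"
    using assms R \<open>s \<ge> 0\<close> by (intro nearest_point_extends_in_ball) auto
  then have "R + s \<in> A" using R \<open>s \<ge> 0\<close> by (auto simp: A s_def)
  then have "s \<le> 0" using max by force
  then have "R = r1" using \<open>e > 0\<close> R by (auto simp: s_def min_def split: if_splits)
  then show ?thesis using R by simp
qed

section \<open>Consequences of the definitions of tangent and normal cone\<close>

text \<open>If every \<open>e\<close> failed, the values 1/(k+1) would yield points of
  \<open>E\<close> and scales \<open>t k\<close> such that the multipliers \<open>1 / t k\<close>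
  exhibit \<open>v\<close> as a tangent vector. One \<open>e\<close> bounds both the opening and the
  length of the cone.\<close>

lemma not_tangent_cone_avoids:
  assumes "v \<notin> tangent_cone E a"
  obtains e where "e > 0" "\<And>t. 0 < t \<Longrightarrow> t < e \<Longrightarrow> ball (a + t *\<^sub>R v) (e * t) \<inter> E = {}"
proof (rule ccontr)
  assume "\<not> thesis"
  with that have "\<exists>t p. 0 < t \<and> t < inverse (real (Suc k)) \<and> p \<in> E \<and>
      dist (a + t *\<^sub>R v) p < inverse (real (Suc k)) * t" for k
    by (metis disjoint_iff inverse_positive_iff_positive mem_ball of_nat_0_less_iff zero_less_Suc)
  then obtain t p where t: "\<And>k. 0 < t k" "\<And>k. t k < inverse (real (Suc k))"
    and p: "\<And>k. p k \<in> E" "\<And>k. dist (a + t k *\<^sub>R v) (p k) < inverse (real (Suc k)) * t k"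
    by metis
  have t0: "t \<longlonglongrightarrow> 0"
    by (rule tendsto_zero_if_less_inverse) (use t in \<open>simp add: abs_of_pos\<close>)
  have v: "(\<lambda>k. (1 / t k) *\<^sub>R (p k - a)) \<longlonglongrightarrow> v"
  proof (rule LIM_zero_cancel, rule tendsto_zero_if_less_inverse)
    show "norm ((1 / t k) *\<^sub>R (p k - a) - v) < inverse (real (Suc k))" for k
    proof -
      have "(1 / t k) *\<^sub>R (p k - a) - v = (1 / t k) *\<^sub>R (p k - (a + t k *\<^sub>R v))"
        using t(1)[of k] by (simp add: algebra_simps)
      then have "norm ((1 / t k) *\<^sub>R (p k - a) - v) = dist (a + t k *\<^sub>R v) (p k) / t k"
        using t(1)[of k] by (simp add: dist_norm norm_minus_commute)
      also have "\<dots> < inverse (real (Suc k))"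
        using p(2)[of k] t(1)[of k] by (simp only: pos_divide_less_eq)
      finally show ?thesis .
    qed
  qed
  have "(\<lambda>k. a + t k *\<^sub>R ((1 / t k) *\<^sub>R (p k - a))) \<longlonglongrightarrow> a + 0 *\<^sub>R v"
    by (intro tendsto_intros t0 v)
  moreover have "a + t k *\<^sub>R ((1 / t k) *\<^sub>R (p k - a)) = p k" for k
    using t(1)[of k] by simp
  ultimately have "p \<longlonglongrightarrow> a" by simp
  then have "v \<in> tangent_cone E a"
    unfolding tangent_cone_def using p(1) t(1) v
    by (auto intro!: exI[of _ p] exI[of _ "\<lambda>k. 1 / t k"])
  with assms show False by contradiction
qed

text \<open>Blow-up at \<open>a\<close>: the quotients (x - a) / t are bounded, a limit
  \<open>l\<close> of them is tangent to \<open>X\<close>, and |l - v| <= 1 together with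
  \<open>v \<bullet> l \<le> 0\<close> leaves only \<open>l = 0\<close>.\<close>

lemma nearest_point_near_foot_of_normal:
  assumes "a \<in> X" and v: "v \<in> unit_normals X a" and "\<eta> > 0"
  obtains t0 where "t0 > 0"
    "\<And>t x. 0 < t \<Longrightarrow> t < t0 \<Longrightarrow> x \<in> nearest_points X (a + t *\<^sub>R v) \<Longrightarrow> norm (x - a) \<le> \<eta> * t"
proof (rule ccontr)
  assume "\<not> thesis"
  with that have "\<exists>t x. 0 < t \<and> t < inverse (real (Suc k)) \<and>
      x \<in> nearest_points X (a + t *\<^sub>R v) \<and> norm (x - a) > \<eta> * t" for k
    by (metis inverse_positive_iff_positive not_le of_nat_0_less_iff zero_less_Suc)
  then obtain t x where t: "\<And>k. 0 < t k" "\<And>k. t k < inverse (real (Suc k))"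
    and x: "\<And>k. x k \<in> nearest_points X (a + t k *\<^sub>R v)" "\<And>k. norm (x k - a) > \<eta> * t k"
    by metis
  have v1: "norm v = 1" using v by (simp add: unit_normals_def)
  define w where "w k = (1 / t k) *\<^sub>R (x k - a)" for k
  have t0: "t \<longlonglongrightarrow> 0"
    by (rule tendsto_zero_if_less_inverse) (use t in \<open>simp add: abs_of_pos\<close>)
  have xw: "x k = a + t k *\<^sub>R w k" for k using t(1)[of k] by (simp add: w_def)
  \<comment> \<open>The point \<open>a\<close> competes with \<open>x k\<close> and has distance
    \<open>t k\<close> from the centre; division by \<open>t k\<close> gives the bound 1.\<close>
  have wv: "norm (w k - v) \<le> 1" for k
  proof -
    have "norm (a + t k *\<^sub>R v - x k) \<le> norm (a + t k *\<^sub>R v - a)"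
      using x(1) assms(1) by (rule nearest_points_norm_le)
    moreover have "a + t k *\<^sub>R v - x k = t k *\<^sub>R (v - w k)" by (simp add: xw algebra_simps)
    ultimately show ?thesis
      using t(1)[of k] v1 by (simp add: norm_minus_commute)
  qed
  have w\<eta>: "norm (w k) \<ge> \<eta>" for k
    using x(2)[of k] t(1)[of k] by (simp add: w_def pos_le_divide_eq)
  have "norm (w k) \<le> 2" for k
    using norm_triangle_ineq2[of "w k" v] wv[of k] v1 by linarith
  then have "bounded (range w)" by (auto simp: bounded_iff)
  then obtain l r where r: "strict_mono (r :: nat \<Rightarrow> nat)" and l: "(w \<circ> r) \<longlonglongrightarrow> l"
    using bounded_imp_convergent_subsequence by blast
  have "(\<lambda>k. a + (t \<circ> r) k *\<^sub>R (w \<circ> r) k) \<longlonglongrightarrow> a + 0 *\<^sub>R l"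
    by (intro tendsto_intros LIMSEQ_subseq_LIMSEQ[OF t0 r] l)
  then have "(x \<circ> r) \<longlonglongrightarrow> a" by (simp add: o_def flip: xw)
  then have "l \<in> tangent_cone X a"
    unfolding tangent_cone_def using x(1) t(1) l
    by (auto intro!: exI[of _ "x \<circ> r"] exI[of _ "\<lambda>k. 1 / t (r k)"]
        simp: nearest_points_def w_def o_def)
  then have "v \<bullet> l \<le> 0" using v by (simp add: unit_normals_def normal_cone_def)
  have "(\<lambda>k. norm ((w \<circ> r) k - v)) \<longlonglongrightarrow> norm (l - v)" by (intro tendsto_intros l)
  then have "norm (l - v) \<le> 1" by (rule LIMSEQ_le_const2) (simp add: wv)
  then have "(norm (l - v))\<^sup>2 \<le> 1" by (simp add: power_le_one)
  \<comment> \<open>Expansion of |l - v|^2 <= 1 with |v| = 1, after which the two units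
    cancel.\<close>
  then have "(norm l)\<^sup>2 - 2 * (v \<bullet> l) \<le> 0"
    using v1 by (simp add: power2_norm_eq_inner inner_diff inner_commute norm_eq_1)
  with \<open>v \<bullet> l \<le> 0\<close> have "(norm l)\<^sup>2 \<le> 0" by linarith
  then have "l = 0" by simp
  have "(\<lambda>k. norm ((w \<circ> r) k)) \<longlonglongrightarrow> norm l" by (intro tendsto_intros l)
  then have "norm l \<ge> \<eta>" by (rule LIMSEQ_le_const) (simp add: w\<eta>)
  with \<open>l = 0\<close> \<open>\<eta> > 0\<close> show False by simp
qed

section \<open>Positive reach in normal directions not tangent to the medial axis\<close>

text \<open>The length \<open>\<sigma>\<close> depends only on the opening \<open>e\<close>. A
  tolerance \<open>\<eta>\<close> controls the errors in foot point and direction; for each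
  \<open>\<eta>\<close> one small \<open>t\<close> is picked, and \<open>\<eta>\<close> tends to 0
  at the end.\<close>

lemma reaching_radius_pos_if_not_tangent:
  assumes "closed X" and "a \<in> X" and v: "v \<in> unit_normals X a"
    and "v \<notin> tangent_cone (medial_axis X) a"
  shows "\<exists>\<sigma>>0. a \<in> nearest_points X (a + \<sigma> *\<^sub>R v)"
proof -
  obtain e where "e > 0"
    and e: "\<And>t. 0 < t \<Longrightarrow> t < e \<Longrightarrow> ball (a + t *\<^sub>R v) (e * t) \<inter> medial_axis X = {}"
    using not_tangent_cone_avoids[OF assms(4)] by blast
  define W where "W = (\<Union>t\<in>{0<..<e}. ball (a + t *\<^sub>R v) (e * t))"
  have W: "open W" "W \<inter> medial_axis X = {}" using e unfolding W_def by (blast intro: open_UN open_ball, fastforce)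
  have v1: "norm v = 1" using v by (simp add: unit_normals_def)
  define \<sigma> where "\<sigma> = e / 2"
  have \<sigma>: "\<sigma> > 0" "\<sigma> < e" using \<open>e > 0\<close> by (auto simp: \<sigma>_def)
  \<comment> \<open>Of the error, 4 \<eta> (\<sigma> - t) is the distance of the end of the ray from
    \<open>a + \<sigma> *\<^sub>R v\<close>, and \<eta> t comes from |r - t|. The bound 1/2 ensures
    \<open>r \<ge> t / 2\<close>, and \<open>4 * \<eta> < e\<close> keeps the ray in
    \<open>W\<close>.\<close>
  have bound: "\<sigma> \<le> infdist (a + \<sigma> *\<^sub>R v) X + 5 * \<eta> * \<sigma>" if \<eta>: "0 < \<eta>" "\<eta> \<le> 1 / 2" "4 * \<eta> < e" for \<eta>
  proof -
    obtain t0 where "t0 > 0" and t0: "\<And>t x. 0 < t \<Longrightarrow> t < t0 \<Longrightarrow>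
        x \<in> nearest_points X (a + t *\<^sub>R v) \<Longrightarrow> norm (x - a) \<le> \<eta> * t"
      using nearest_point_near_foot_of_normal[OF \<open>a \<in> X\<close> v \<open>0 < \<eta>\<close>] by blast
    \<comment> \<open>Below \<open>t0\<close> for the foot estimate, and at most
      \<open>\<sigma>\<close> so that the length \<open>\<sigma> - t\<close> still to be covered is
      nonnegative.\<close>
    define t where "t = min (t0 / 2) \<sigma>"
    have t: "0 < t" "t < t0" "t \<le> \<sigma>" using \<open>t0 > 0\<close> \<sigma> by (auto simp: t_def)
    obtain x where x: "x \<in> nearest_points X (a + t *\<^sub>R v)"
      using nearest_points_exists[OF \<open>closed X\<close>] \<open>a \<in> X\<close> by (metis empty_iff)
    have xa: "norm (x - a) \<le> \<eta> * t" using t0 t x by blast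
    define r where "r = norm (a + t *\<^sub>R v - x)"
    define u where "u = (1 / r) *\<^sub>R (a + t *\<^sub>R v - x)"
    have "norm (t *\<^sub>R v) = t" using t v1 by simp
    then have rt: "\<bar>r - t\<bar> \<le> \<eta> * t"
      using norm_triangle_ineq3[of "a + t *\<^sub>R v - x" "t *\<^sub>R v"] xa
      by (simp add: r_def norm_minus_commute)
    moreover have "\<eta> * t \<le> t / 2" using \<eta> t by simp
    ultimately have r: "r \<ge> t / 2" "r > 0" using t by linarith+
    have u1: "norm u = 1" using r(2) by (simp add: u_def flip: r_def)
    have ru: "x + r *\<^sub>R u = a + t *\<^sub>R v" using r(2) by (simp add: u_def)
    then have x_eq: "x = a + t *\<^sub>R v - r *\<^sub>R u" by (simp add: eq_diff_eq)
    \<comment> \<open>The foot point and the length \<open>r\<close> each contribute an error \<eta>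
      t; division by \<open>r \<ge> t / 2\<close> turns 2 \<eta> t into 4 \<eta>.\<close>
    have uv: "norm (u - v) \<le> 4 * \<eta>"
    proof -
      have "r *\<^sub>R (u - v) = (t - r) *\<^sub>R v - (x - a)" by (simp add: x_eq algebra_simps)
      then have "r * norm (u - v) = norm ((t - r) *\<^sub>R v - (x - a))"
        using r by (metis abs_of_pos norm_scaleR)
      also have "\<dots> \<le> \<bar>t - r\<bar> + norm (x - a)"
        using norm_triangle_ineq4[of "(t - r) *\<^sub>R v" "x - a"] v1 by simp
      also have "\<dots> \<le> 2 * \<eta> * t" using rt xa by linarith
      also have "\<dots> \<le> r * (4 * \<eta>)"
        using mult_left_mono[OF r(1), of "4 * \<eta>"] \<eta> by (simp add: algebra_simps)
      finally show ?thesis using r by simp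
    qed
    have ray: "x + (r + s) *\<^sub>R u = a + (t + s) *\<^sub>R v + s *\<^sub>R (u - v)" for s
      by (simp add: x_eq algebra_simps)
    have near: "dist (a + (t + s) *\<^sub>R v) (x + (r + s) *\<^sub>R u) \<le> 4 * \<eta> * s" if "s \<ge> 0" for s
      using mult_left_mono[OF uv that] that by (simp add: ray dist_norm mult.commute)
    have inW: "x + r' *\<^sub>R u \<in> W" if r': "r \<le> r'" "r' \<le> r + (\<sigma> - t)" for r'
    proof -
      define s where "s = r' - r"
      have s: "s \<ge> 0" "t + s \<le> \<sigma>" "r' = r + s" using r' by (auto simp: s_def)
      have "4 * \<eta> * s \<le> e * s" using \<eta> s by (intro mult_right_mono) auto
      \<comment> \<open>The strictness required by the open ball comes from \<open>t > 0\<close>,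
        and so holds at the start \<open>s = 0\<close> as well.\<close>
      also have "\<dots> < e * (t + s)" using t \<open>e > 0\<close> by simp
      finally have "x + r' *\<^sub>R u \<in> ball (a + (t + s) *\<^sub>R v) (e * (t + s))"
        using near[OF s(1)] s(3) by simp
      then show ?thesis using s t \<sigma> unfolding W_def by (intro UN_I[of "t + s"]) auto
    qed
    have "x \<in> nearest_points X (x + r *\<^sub>R u)" using x by (simp only: ru)
    moreover have "r \<le> r + (\<sigma> - t)" using t by simp
    ultimately have "x \<in> nearest_points X (x + (r + (\<sigma> - t)) *\<^sub>R u)"
      using nearest_point_extends_along_ray[OF \<open>closed X\<close> u1 _ r(2) _ W inW] by blast
    then have "infdist (x + (r + (\<sigma> - t)) *\<^sub>R u) X = r + (\<sigma> - t)"
      using u1 r t by (simp add: nearest_points_def)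
    moreover have "infdist (x + (r + (\<sigma> - t)) *\<^sub>R u) X
        \<le> infdist (a + \<sigma> *\<^sub>R v) X + dist (x + (r + (\<sigma> - t)) *\<^sub>R u) (a + \<sigma> *\<^sub>R v)"
      by (rule infdist_triangle)
    moreover have "dist (x + (r + (\<sigma> - t)) *\<^sub>R u) (a + \<sigma> *\<^sub>R v) \<le> 4 * \<eta> * (\<sigma> - t)"
      using near[of "\<sigma> - t"] t by (simp add: dist_commute)
    moreover have "4 * \<eta> * (\<sigma> - t) \<le> 4 * \<eta> * \<sigma>" "\<eta> * t \<le> \<eta> * \<sigma>"
      using \<eta> t by auto
    ultimately show ?thesis using rt by linarith
  qed
  have "((\<lambda>\<eta>. infdist (a + \<sigma> *\<^sub>R v) X + 5 * \<eta> * \<sigma>) \<longlongrightarrow>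
      infdist (a + \<sigma> *\<^sub>R v) X + 5 * 0 * \<sigma>) (at_right 0)"
    by (intro tendsto_intros)
  moreover have "\<forall>\<^sub>F \<eta> in at_right 0. \<sigma> \<le> infdist (a + \<sigma> *\<^sub>R v) X + 5 * \<eta> * \<sigma>"
    unfolding eventually_at_right_field
    by (rule exI[of _ "min (1 / 2) (e / 4)"]) (use \<open>e > 0\<close> in \<open>auto intro!: bound\<close>)
  ultimately have "\<sigma> \<le> infdist (a + \<sigma> *\<^sub>R v) X + 5 * 0 * \<sigma>"
    by (rule tendsto_lowerbound) simp
  then have "a \<in> nearest_points X (a + \<sigma> *\<^sub>R v)"
    using \<open>a \<in> X\<close> v1 \<sigma> by (simp add: nearest_points_iff_le)
  with \<sigma> show ?thesis by blast
qed

theorem theorem5p4: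
  fixes S :: "nat \<Rightarrow> real list set set"
    and X :: "(real ^ 'n) set"
    and a v :: "real ^ 'n"
  assumes "poly_bounded_o_minimal_structure S"
    and "definable_set S X"
    and "closed X" and "X \<noteq> {}" and "X \<noteq> UNIV"
    and "a \<in> X"
    and "v \<in> unit_normals X a"
    and "reaching_radius X a v = 0"
  shows "v \<in> tangent_cone (medial_axis X) a"
proof (rule ccontr)
  assume "v \<notin> tangent_cone (medial_axis X) a"
  then obtain \<sigma> where \<sigma>: "\<sigma> > 0" "a \<in> nearest_points X (a + \<sigma> *\<^sub>R v)"
    using reaching_radius_pos_if_not_tangent assms by blast
  then have "ereal \<sigma> \<le> reaching_radius X a v"
    unfolding reaching_radius_def by (intro SUP_upper) auto
  with \<sigma> assms(8) show False by simp
qed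

end
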